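(* Let $(P,\cdot,\circ)$ be a finite-dimensional transposed Novikov-Poisson algebra over a field $\mathbf{k}$ with $\operatorname{char}\mathbf{k}\neq 2$. Then both the underlying commutative associative algebra $P_A=(P,\cdot)$ and the underlying Novikov algebra $P_N=(P,\circ)$ are nilpotent if and only if $P$ is nilpotent.
   Context: A (left) Novikov algebra $(P,\circ)$ is a vector space with a bilinear operation satisfying $(x\circ y)\circ z=(x\circ z)\circ y$ and $(x\circ y)\circ z-x\circ(y\circ z)=(y\circ x)\circ z-y\circ(x\circ z)$ for all $x,y,z$. A transposed Novikov-Poisson algebra is a triple $(P,\cdot,\circ)$ such that $(P,\cdot)$ is a commutative associative algebra (not necessarily unital), $(P,\circ)$ is a Novikov algebra, and for all $x,y,z\in P$: $(x\cdot y)\circ z=(x\cdot z)\circ y$ and $2z\cdot(x\circ y)=(z\cdot x)\circ y+x\circ(z\cdot y)$. For subspaces $X,Y$ of $P$, $X\cdot Y$ (resp. $X\circ Y$) denotes the linear span of all $x\cdot y$ (resp. $x\circ y$), $x\in X$, $y\in Y$. $P$ is nilpotent if $P^m=0$ for some $m\ge1$, where $P^1=P$ and $P^n=\sum_{i=1}^{n-1}(P^i\cdot P^{n-i}+P^i\circ P^{n-i})$ for $n\ge 2$. An algebra $(N,* )$ with a single product is nilpotent if $N^m=0$ for some $m\ge 1$, where $N^1=N$ and $N^n=\sum_{i=1}^{n-1}N^i*N^{n-i}$ for $n\ge 2$; this applies to $P_A$ (with $*=\cdot$) and $P_N$ (with $*=\circ$). *)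

theory Defs
  imports Complex_Main
begin

definition bilinear_op :: "('a::field \<Rightarrow> 'b::ab_group_add \<Rightarrow> 'b) \<Rightarrow> ('b \<Rightarrow> 'b \<Rightarrow> 'b) \<Rightarrow> bool" where
  "bilinear_op scale f \<longleftrightarrow>
     (\<forall>y. Vector_Spaces.linear scale scale (\<lambda>x. f x y)) \<and>
     (\<forall>x. Vector_Spaces.linear scale scale (\<lambda>y. f x y))"

definition span_prod ::
  "('a::field \<Rightarrow> 'b::ab_group_add \<Rightarrow> 'b) \<Rightarrow> ('b \<Rightarrow> 'b \<Rightarrow> 'b) \<Rightarrow> 'b set \<Rightarrow> 'b set \<Rightarrow> 'b set" where
  "span_prod scale f X Y = module.span scale {f x y | x y. x \<in> X \<and> y \<in> Y}"

text \<open>In the two definitions below, the sum of a finite family of subspaces is the span of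
  their union. The value at index \<open>0\<close> is a dummy: it is used neither in the recursion nor in
  the nilpotency predicates.\<close>

function alg_power ::
  "('a::field \<Rightarrow> 'b::ab_group_add \<Rightarrow> 'b) \<Rightarrow> ('b \<Rightarrow> 'b \<Rightarrow> 'b) \<Rightarrow> nat \<Rightarrow> 'b set" where
  "alg_power scale f n =
     (if n \<le> 1 then UNIV
      else module.span scale
        (\<Union>i\<in>{1..<n}. span_prod scale f (alg_power scale f i) (alg_power scale f (n - i))))"
  by auto
termination by (relation "measure (\<lambda>(s, f, n). n)") auto

function alg_power2 ::
  "('a::field \<Rightarrow> 'b::ab_group_add \<Rightarrow> 'b) \<Rightarrow> ('b \<Rightarrow> 'b \<Rightarrow> 'b) \<Rightarrow> ('b \<Rightarrow> 'b \<Rightarrow> 'b) \<Rightarrow> nat \<Rightarrow> 'b set" where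
  "alg_power2 scale f g n =
     (if n \<le> 1 then UNIV
      else module.span scale
        (\<Union>i\<in>{1..<n}.
           span_prod scale f (alg_power2 scale f g i) (alg_power2 scale f g (n - i)) \<union>
           span_prod scale g (alg_power2 scale f g i) (alg_power2 scale f g (n - i))))"
  by auto
termination by (relation "measure (\<lambda>(s, f, g, n). n)") auto

declare alg_power.simps [simp del] alg_power2.simps [simp del]

definition nilpotent_alg ::
  "('a::field \<Rightarrow> 'b::ab_group_add \<Rightarrow> 'b) \<Rightarrow> ('b \<Rightarrow> 'b \<Rightarrow> 'b) \<Rightarrow> bool" where
  "nilpotent_alg scale f \<longleftrightarrow> (\<exists>m\<ge>1. alg_power scale f m = {0})"

definition nilpotent_alg2 ::
  "('a::field \<Rightarrow> 'b::ab_group_add \<Rightarrow> 'b) \<Rightarrow> ('b \<Rightarrow> 'b \<Rightarrow> 'b) \<Rightarrow> ('b \<Rightarrow> 'b \<Rightarrow> 'b) \<Rightarrow> bool" where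
  "nilpotent_alg2 scale f g \<longleftrightarrow> (\<exists>m\<ge>1. alg_power2 scale f g m = {0})"

locale comm_assoc_algebra = vector_space scale + abel_semigroup dot
  for scale :: "'a::field \<Rightarrow> 'b::ab_group_add \<Rightarrow> 'b"
    and dot :: "'b \<Rightarrow> 'b \<Rightarrow> 'b" +
  assumes bilinear_dot: "bilinear_op scale dot"

locale novikov_algebra = vector_space scale
  for scale :: "'a::field \<Rightarrow> 'b::ab_group_add \<Rightarrow> 'b"
    and circ :: "'b \<Rightarrow> 'b \<Rightarrow> 'b" +
  assumes bilinear_circ: "bilinear_op scale circ"
    and right_commutative: "circ (circ x y) z = circ (circ x z) y"
    and left_symmetric:
      "circ (circ x y) z - circ x (circ y z) = circ (circ y x) z - circ y (circ x z)"

locale transposed_novikov_poisson_algebra =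
  comm_assoc_algebra scale dot + novikov_algebra scale circ
  for scale :: "'a::field \<Rightarrow> 'b::ab_group_add \<Rightarrow> 'b"
    and dot :: "'b \<Rightarrow> 'b \<Rightarrow> 'b"
    and circ :: "'b \<Rightarrow> 'b \<Rightarrow> 'b" +
  assumes dot_circ: "circ (dot x y) z = circ (dot x z) y"
    and transposed_leibniz:
      "scale 2 (dot z (circ x y)) = circ (dot z x) y + circ x (dot z y)"

end

theory Submission
  imports Defs
begin

text \<open>The transposed Leibniz rule \<open>2 z(x \<circ> y) = (z x) \<circ> y + x \<circ> (z y)\<close> lets one move every
  multiplication by \<open>\<cdot>\<close> in an iterated product past the multiplications by \<open>\<circ>\<close> to the outermost
  position, at the cost of terms in which its factor is absorbed into the other operand of \<open>\<circ>\<close>.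
  The number of \<open>\<circ>\<close>-multiplications does not change, so if it is large the
  product vanishes by nilpotency of \<open>\<circ>\<close>. If it is small, only few \<open>\<cdot>\<close>-factors can be absorbed
  before an operand vanishes by nilpotency of \<open>\<cdot>\<close>; all remaining ones are outermost, and
  the product vanishes again when there are many of them. Finally, a product of at least \<open>2\<^sup>k\<close>
  elements, bracketed in any way, is an iterated product of \<open>k\<close> one-sided multiplications.\<close>

lemma (in vector_space) bilinear_op_simps:
  assumes "bilinear_op scale f"
  shows "f (x + y) z = f x z + f y z" "f x (y + z) = f x y + f x z"
    "f (scale c x) y = scale c (f x y)" "f x (scale c y) = scale c (f x y)"
    "f 0 x = 0" "f x 0 = 0"
proof -
  have l: "module_hom scale scale (\<lambda>x. f x y)" for y
    using assms unfolding bilinear_op_def by (blast dest: Vector_Spaces.linear.axioms(3))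
  have r: "module_hom scale scale (f x)" for x
    using assms unfolding bilinear_op_def by (blast dest: Vector_Spaces.linear.axioms(3))
  show "f (x + y) z = f x z + f y z" "f x (y + z) = f x y + f x z"
    "f (scale c x) y = scale c (f x y)" "f x (scale c y) = scale c (f x y)"
    "f 0 x = 0" "f x 0 = 0"
    using module_hom.add[OF l] module_hom.add[OF r] module_hom.scale[OF l] module_hom.scale[OF r]
      module_hom.zero[OF l] module_hom.zero[OF r] by simp_all
qed

section \<open>Powers with respect to one or two products\<close>

context vector_space
begin

lemma subspace_alg_power: "subspace (alg_power scale f n)"
  by (subst alg_power.simps) simp

lemma subspace_alg_power2: "subspace (alg_power2 scale f g n)"
  by (subst alg_power2.simps) simp

lemma alg_power_mult:
  assumes "i \<ge> 1" "j \<ge> 1" "x \<in> alg_power scale f i" "y \<in> alg_power scale f j"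
  shows "f x y \<in> alg_power scale f (i + j)"
proof -
  have "f x y \<in> span_prod scale f (alg_power scale f i) (alg_power scale f (i + j - i))"
    unfolding span_prod_def using assms by (intro span_base) auto
  moreover have "i \<in> {1..<i+j}" using assms by auto
  ultimately have "f x y \<in> (\<Union>i'\<in>{1..<i+j}. span_prod scale f (alg_power scale f i')
      (alg_power scale f (i + j - i')))" by blast
  then show ?thesis
    using assms by (subst alg_power.simps) (auto intro: span_base)
qed

lemma alg_power_subsetI:
  assumes "n \<ge> 2" "subspace V"
    and "\<And>i x y. 1 \<le> i \<Longrightarrow> i < n \<Longrightarrow> x \<in> alg_power scale f i \<Longrightarrow> y \<in> alg_power scale f (n - i)
      \<Longrightarrow> f x y \<in> V"
  shows "alg_power scale f n \<subseteq> V"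
proof -
  have "(\<Union>i\<in>{1..<n}. span_prod scale f (alg_power scale f i) (alg_power scale f (n - i))) \<subseteq> V"
    unfolding span_prod_def using assms by (intro UN_least span_minimal) auto
  then show ?thesis
    using assms by (subst alg_power.simps) (auto intro: span_minimal[THEN subsetD])
qed

lemma alg_power2_mult:
  assumes "i \<ge> 1" "j \<ge> 1" "x \<in> alg_power2 scale f g i" "y \<in> alg_power2 scale f g j"
  shows "f x y \<in> alg_power2 scale f g (i + j)" "g x y \<in> alg_power2 scale f g (i + j)"
proof -
  let ?S = "\<lambda>h i'. span_prod scale h (alg_power2 scale f g i') (alg_power2 scale f g (i + j - i'))"
  have "f x y \<in> ?S f i" "g x y \<in> ?S g i"
    unfolding span_prod_def using assms by (auto intro: span_base)
  moreover have "i \<in> {1..<i+j}" using assms by auto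
  ultimately have "f x y \<in> (\<Union>i'\<in>{1..<i+j}. ?S f i' \<union> ?S g i')"
    "g x y \<in> (\<Union>i'\<in>{1..<i+j}. ?S f i' \<union> ?S g i')" by blast+
  moreover have "alg_power2 scale f g (i + j) = span (\<Union>i'\<in>{1..<i+j}. ?S f i' \<union> ?S g i')"
    using assms by (subst alg_power2.simps) simp
  ultimately show "f x y \<in> alg_power2 scale f g (i + j)" "g x y \<in> alg_power2 scale f g (i + j)"
    by (simp_all only: span_base)
qed

lemma alg_power2_subsetI:
  assumes "n \<ge> 2" "subspace V"
    and "\<And>i x y. 1 \<le> i \<Longrightarrow> i < n \<Longrightarrow> x \<in> alg_power2 scale f g i \<Longrightarrow> y \<in> alg_power2 scale f g (n - i)
      \<Longrightarrow> f x y \<in> V \<and> g x y \<in> V"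
  shows "alg_power2 scale f g n \<subseteq> V"
proof -
  have "(\<Union>i\<in>{1..<n}.
      span_prod scale f (alg_power2 scale f g i) (alg_power2 scale f g (n - i)) \<union>
      span_prod scale g (alg_power2 scale f g i) (alg_power2 scale f g (n - i))) \<subseteq> V"
    unfolding span_prod_def using assms by (intro UN_least Un_least span_minimal) auto
  then show ?thesis
    using assms by (subst alg_power2.simps) (auto intro: span_minimal[THEN subsetD])
qed

text \<open>Bracketings in a single product occur among those that may mix both; this gives the easy
  implication of the theorem.\<close>

lemma alg_power_subset_alg_power2:
  "alg_power scale f n \<subseteq> alg_power2 scale f g n"
  "alg_power scale g n \<subseteq> alg_power2 scale f g n"
proof (induction n rule: less_induct)
  case (less n)
  have "alg_power scale f n \<subseteq> alg_power2 scale f g n \<and>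
      alg_power scale g n \<subseteq> alg_power2 scale f g n"
  proof (cases "n \<ge> 2")
    case True
    have *: "x \<in> alg_power2 scale f g i \<Longrightarrow> y \<in> alg_power2 scale f g (n - i) \<Longrightarrow>
        f x y \<in> alg_power2 scale f g n \<and> g x y \<in> alg_power2 scale f g n"
      if "1 \<le> i" "i < n" for i x y
      using alg_power2_mult[of i "n - i" x f g y] that by simp
    show ?thesis
    proof (intro conjI)
      show "alg_power scale f n \<subseteq> alg_power2 scale f g n"
      proof (rule alg_power_subsetI[OF True subspace_alg_power2])
        fix i x y
        assume "1 \<le> i" "i < n" "x \<in> alg_power scale f i" "y \<in> alg_power scale f (n - i)"
        then show "f x y \<in> alg_power2 scale f g n"
          using *[of i x y] less(1)[of i] less(1)[of "n - i"] by auto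
      qed
      show "alg_power scale g n \<subseteq> alg_power2 scale f g n"
      proof (rule alg_power_subsetI[OF True subspace_alg_power2])
        fix i x y
        assume "1 \<le> i" "i < n" "x \<in> alg_power scale g i" "y \<in> alg_power scale g (n - i)"
        then show "g x y \<in> alg_power2 scale f g n"
          using *[of i x y] less(2)[of i] less(2)[of "n - i"] by auto
      qed
    qed
  next
    case False
    then show ?thesis by (simp add: alg_power2.simps)
  qed
  then show "alg_power scale f n \<subseteq> alg_power2 scale f g n"
    "alg_power scale g n \<subseteq> alg_power2 scale f g n" by auto
qed

text \<open>In each generating product the induction hypothesis lowers the index of one factor by
  one.\<close>

lemma alg_power_Suc_subset: "alg_power scale f (Suc n) \<subseteq> alg_power scale f n"
proof (induction n rule: less_induct)
  case (less n)
  show ?case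
  proof (cases "n \<ge> 2")
    case True
    show ?thesis
    proof (rule alg_power_subsetI[OF _ subspace_alg_power])
      fix i x y
      assume i: "1 \<le> i" "i < Suc n" and x: "x \<in> alg_power scale f i"
        and y: "y \<in> alg_power scale f (Suc n - i)"
      show "f x y \<in> alg_power scale f n"
      proof (cases "i = 1")
        case True
        \<comment> \<open>Index 1 of the left factor cannot be lowered, as the value at 0 is a
          dummy, so the right one is.\<close>
        have "y \<in> alg_power scale f (n - 1)"
          using less[of "n - 1"] y \<open>i = 1\<close> \<open>n \<ge> 2\<close> by auto
        then show ?thesis
          using alg_power_mult[of 1 "n - 1" x f y] x \<open>i = 1\<close> \<open>n \<ge> 2\<close> by auto
      next
        case False
        have "x \<in> alg_power scale f (i - 1)"
          using less[of "i - 1"] x i False by (cases i) auto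
        then show ?thesis
          using alg_power_mult[of "i - 1" "Suc n - i" x f y] y i False by auto
      qed
    qed (use True in simp)
  qed (simp add: alg_power.simps[of _ _ n])
qed

lemma alg_power_antimono:
  assumes "m \<le> n"
  shows "alg_power scale f n \<subseteq> alg_power scale f m"
  using assms
proof (induction n rule: dec_induct)
  case (step n)
  then show ?case using alg_power_Suc_subset[of f n] by blast
qed simp

lemma alg_power_1: "alg_power scale f (Suc 0) = UNIV"
  by (simp add: alg_power.simps)

end

section \<open>Normal forms of iterated products\<close>

context transposed_novikov_poisson_algebra
begin

lemmas dot_simps = bilinear_op_simps[OF bilinear_dot]
lemmas circ_simps = bilinear_op_simps[OF bilinear_circ]

text \<open>The transposed Leibniz rule solved for one summand. \<open>scale (- 1)\<close> replaces
  subtraction to fit the closure rules \<open>add\<close> and \<open>scale\<close> of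
  \<open>normal_form\<close>.\<close>

lemma circ_dot_right: "circ w (dot a v) = scale 2 (dot a (circ w v)) + scale (- 1) (circ (dot a w) v)"
  using transposed_leibniz[of a w v] by simp

lemma circ_dot_left: "circ (dot a v) w = scale 2 (dot a (circ v w)) + scale (- 1) (circ v (dot a w))"
  using transposed_leibniz[of a v w] by simp

text \<open>\<open>circ_word c e v\<close>: \<open>v\<close> is an iterated product of \<open>c\<close> one-sided multiplications by \<open>\<circ>\<close>
  whose operands contain at least \<open>e\<close> absorbed \<open>\<cdot>\<close>-factors in total.\<close>

inductive circ_word :: "nat \<Rightarrow> nat \<Rightarrow> 'b \<Rightarrow> bool" where
  base: "circ_word 0 0 x"
| left: "circ_word c e v \<Longrightarrow> w \<in> alg_power scale dot (Suc q) \<Longrightarrow> circ_word (Suc c) (e + q) (circ w v)"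
| right: "circ_word c e v \<Longrightarrow> w \<in> alg_power scale dot (Suc q) \<Longrightarrow> circ_word (Suc c) (e + q) (circ v w)"

text \<open>In \<open>normal_form c d v\<close>, the index \<open>d\<close> counts the outermost as well as the absorbed
  \<open>\<cdot>\<close>-factors.\<close>

inductive normal_form :: "nat \<Rightarrow> nat \<Rightarrow> 'b \<Rightarrow> bool" where
  word: "circ_word c d v \<Longrightarrow> normal_form c d v"
| dot: "normal_form c d v \<Longrightarrow> normal_form c (Suc d) (dot a v)"
| add: "normal_form c d u \<Longrightarrow> normal_form c d v \<Longrightarrow> normal_form c d (u + v)"
| scale: "normal_form c d v \<Longrightarrow> normal_form c d (scale k v)"

lemma dot_mem_alg_power:
  assumes "w \<in> alg_power scale dot (Suc q)"
  shows "dot a w \<in> alg_power scale dot (Suc (Suc q))"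
  using alg_power_mult[of 1 "Suc q" a dot w] assms by (simp add: alg_power_1)

text \<open>An outermost factor \<open>a\<close> of \<open>v\<close> either stays outermost or is
  absorbed into \<open>w\<close>, so the total count is kept. Absorption changes \<open>w\<close>
  and raises \<open>q\<close>, hence both are generalized in the induction.\<close>

lemma normal_form_circ:
  assumes "normal_form c d v" "w \<in> alg_power scale dot (Suc q)"
  shows "normal_form (Suc c) (d + q) (circ w v) \<and> normal_form (Suc c) (d + q) (circ v w)"
  using assms
proof (induction arbitrary: w q rule: normal_form.induct)
  case (word c d v)
  then show ?case by (blast intro: circ_word.intros normal_form.word)
next
  case (dot c d v a)
  note IH1 = dot.IH[OF dot.prems]
  note IH2 = dot.IH[OF dot_mem_alg_power[OF dot.prems, of a]]
  have "normal_form (Suc c) (Suc (d + q))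
      (scale 2 (dot a (circ w v)) + scale (- 1) (circ (dot a w) v))"
    "normal_form (Suc c) (Suc (d + q))
      (scale 2 (dot a (circ v w)) + scale (- 1) (circ v (dot a w)))"
    using IH1 IH2 by (intro normal_form.add normal_form.scale normal_form.dot; simp)+
  then show ?case by (simp only: circ_dot_left[of a v w] circ_dot_right[of w a v] add_Suc simp_thms)
next
  case (add c d u v)
  then show ?case by (simp add: circ_simps normal_form.add)
next
  case (scale c d v k)
  then show ?case by (simp add: circ_simps normal_form.scale)
qed

lemma circ_word_mem_alg_power: "circ_word c e v \<Longrightarrow> v \<in> alg_power scale circ (Suc c)"
proof (induction rule: circ_word.induct)
  case (base x)
  then show ?case by (simp add: alg_power_1)
next
  case (left c e v w q)
  then show ?case using alg_power_mult[of 1 "Suc c" w circ v] by (simp add: alg_power_1)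
next
  case (right c e v w q)
  then show ?case using alg_power_mult[of "Suc c" 1 v circ w] by (simp add: alg_power_1)
qed

lemma normal_form_circ_bound:
  assumes "normal_form c d v" "alg_power scale circ M = {0}" "M \<le> c"
  shows "v = 0"
  using assms
proof (induction rule: normal_form.induct)
  case (word c d v)
  then show ?case
    using circ_word_mem_alg_power[of c d v] alg_power_antimono[of M "Suc c" circ] by auto
qed (simp_all add: dot_simps)

text \<open>Pigeonhole: if \<open>c\<close> operands absorb more than \<open>c * N\<close> factors,
  some operand absorbs at least \<open>N\<close> and is therefore zero.\<close>

lemma circ_word_dot_bound:
  assumes "circ_word c e v" "alg_power scale dot N = {0}" "c * N < e"
  shows "v = 0"
  using assms
proof (induction rule: circ_word.induct)
  case (left c e v w q)
  have "v = 0 \<or> w = 0"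
  proof (cases "q < N")
    case False
    then show ?thesis using left alg_power_antimono[of N "Suc q" dot] by auto
  qed (use left in auto)
  then show ?case by (auto simp: circ_simps)
next
  case (right c e v w q)
  have "v = 0 \<or> w = 0"
  proof (cases "q < N")
    case False
    then show ?thesis using right alg_power_antimono[of N "Suc q" dot] by auto
  qed (use right in auto)
  then show ?case by (auto simp: circ_simps)
qed simp

text \<open>At most \<open>c * N\<close> factors are absorbed in a nonzero word; each remaining one
  is outermost and raises the power by one.\<close>

lemma normal_form_mem_alg_power:
  assumes "normal_form c d v" "alg_power scale dot N = {0}"
  shows "v \<in> alg_power scale dot (Suc (d - c * N))"
  using assms
proof (induction rule: normal_form.induct)
  case (word c d v)
  \<comment> \<open>Either too many factors are absorbed and \<open>v\<close> is zero, or the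
    truncated difference is 0 and the power is the whole space.\<close>
  then show ?case
    using circ_word_dot_bound[of c d v N] subspace_0[OF subspace_alg_power]
    by (cases "c * N < d") (auto simp: alg_power_1)
next
  case (dot c d v a)
  then have "dot a v \<in> alg_power scale dot (Suc (Suc (d - c * N)))"
    by (simp add: dot_mem_alg_power)
  moreover have "Suc (Suc d - c * N) \<le> Suc (Suc (d - c * N))" by simp
  ultimately show ?case using alg_power_antimono by blast
next
  case (add c d u v)
  then show ?case by (simp add: subspace_add[OF subspace_alg_power])
next
  case (scale c d v k)
  then show ?case by (simp add: subspace_scale[OF subspace_alg_power])
qed

section \<open>Vanishing of long products\<close>

text \<open>The span is needed because \<open>normal_form\<close> is closed under sums only for
  fixed \<open>c\<close> and \<open>d\<close>, while here only their total is fixed.\<close>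

definition word_span :: "nat \<Rightarrow> 'b set" where
  "word_span k = span {v. \<exists>c d. c + d = k \<and> normal_form c d v}"

lemma word_span_mult:
  assumes "v \<in> word_span k"
  shows "dot a v \<in> word_span (Suc k) \<and> circ a v \<in> word_span (Suc k) \<and> circ v a \<in> word_span (Suc k)"
  using assms unfolding word_span_def
proof (induction rule: span_induct_alt)
  case base
  then show ?case by (simp add: dot_simps circ_simps span_zero)
next
  case (step r x y)
  then obtain c d where cd: "c + d = k" and x: "normal_form c d x" by blast
  \<comment> \<open>With \<open>q = 0\<close> the operand \<open>a\<close> may be arbitrary, as the
    first power is the whole space.\<close>
  have "normal_form c (Suc d) (dot a x)" "normal_form (Suc c) d (circ a x)"
    "normal_form (Suc c) d (circ x a)"
    using x normal_form_circ[OF x, of a 0] by (auto simp: alg_power_1 intro: normal_form.dot)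
  moreover have "c + Suc d = Suc k" "Suc c + d = Suc k" using cd by auto
  ultimately have "dot a x \<in> span {v. \<exists>c d. c + d = Suc k \<and> normal_form c d v}"
    "circ a x \<in> span {v. \<exists>c d. c + d = Suc k \<and> normal_form c d v}"
    "circ x a \<in> span {v. \<exists>c d. c + d = Suc k \<and> normal_form c d v}"
    by (blast intro: span_base)+
  with step show ?case by (simp add: dot_simps circ_simps span_add span_scale)
qed

text \<open>One factor of each generating product has at least half the index, so it lies in
  \<open>word_span (k - 1)\<close> by induction when \<open>k\<close> is positive; the other factor
  acts as a one-sided multiplication.\<close>

lemma alg_power2_subset_word_span:
  assumes "2 ^ k \<le> n"
  shows "alg_power2 scale dot circ n \<subseteq> word_span k"
  using assms
proof (induction k arbitrary: n)
  case 0
  have "x \<in> word_span 0" for x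
    unfolding word_span_def
    by (rule span_base) (auto intro: circ_word.base normal_form.word)
  then show ?case by blast
next
  case (Suc k)
  have "(1::nat) \<le> 2 ^ k" by simp
  then have "n \<ge> 2" using Suc.prems by (simp only: power_Suc)
  then show ?case
  proof (rule alg_power2_subsetI)
    show "subspace (word_span (Suc k))" by (simp add: word_span_def)
    fix i x y
    assume "i < n" and x: "x \<in> alg_power2 scale dot circ i"
      and y: "y \<in> alg_power2 scale dot circ (n - i)"
    then consider "2 ^ k \<le> i" | "2 ^ k \<le> n - i" using Suc.prems by fastforce
    then show "dot x y \<in> word_span (Suc k) \<and> circ x y \<in> word_span (Suc k)"
    proof cases
      case 1
      then have "x \<in> word_span k" using Suc.IH x by blast
      then show ?thesis using word_span_mult[of x k y] by (simp add: commute)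
    next
      case 2
      then have "y \<in> word_span k" using Suc.IH y by blast
      then show ?thesis using word_span_mult by blast
    qed
  qed
qed

text \<open>If \<open>c < M\<close>, then \<open>d > M * N + N\<close>, so at least \<open>N\<close>
  factors remain outermost after discounting \<open>c * N\<close> absorbed ones. If
  \<open>M \<le> c\<close>, nilpotency of \<open>circ\<close> suffices.\<close>

lemma word_span_eq_0:
  assumes "alg_power scale dot N = {0}" "alg_power scale circ M = {0}"
  shows "word_span (M + (M * N + N)) \<subseteq> {0}"
  unfolding word_span_def
proof (rule span_minimal)
  show "{v. \<exists>c d. c + d = M + (M * N + N) \<and> normal_form c d v} \<subseteq> {0}"
  proof safe
    fix v c d
    assume cd: "c + d = M + (M * N + N)" and v: "normal_form c d v"
    show "v = 0"
    proof (cases "M \<le> c")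
      case True
      then show ?thesis using normal_form_circ_bound v assms by blast
    next
      case False
      then have "c * N \<le> M * N" by simp
      then have "N \<le> Suc (d - c * N)" using cd False by linarith
      then show ?thesis
        using normal_form_mem_alg_power[OF v assms(1)]
          alg_power_antimono[of N "Suc (d - c * N)" dot] assms(1) by blast
    qed
  qed
qed simp

lemma nilpotent_alg2_iff:
  "nilpotent_alg scale dot \<and> nilpotent_alg scale circ \<longleftrightarrow> nilpotent_alg2 scale dot circ"
proof
  assume "nilpotent_alg scale dot \<and> nilpotent_alg scale circ"
  then obtain N M where NM: "alg_power scale dot N = {0}" "alg_power scale circ M = {0}"
    unfolding nilpotent_alg_def by blast
  let ?n = "2 ^ (M + (M * N + N)) :: nat"
  have "alg_power2 scale dot circ ?n \<subseteq> {0}"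
    using alg_power2_subset_word_span[OF order_refl] word_span_eq_0[OF NM] by blast
  then have "alg_power2 scale dot circ ?n = {0}"
    using subspace_0[OF subspace_alg_power2] by blast
  moreover have "?n \<ge> 1" by simp
  ultimately show "nilpotent_alg2 scale dot circ"
    unfolding nilpotent_alg2_def by blast
next
  assume "nilpotent_alg2 scale dot circ"
  then obtain m where "m \<ge> 1" and m: "alg_power2 scale dot circ m = {0}"
    unfolding nilpotent_alg2_def by blast
  have "alg_power scale dot m = {0}" "alg_power scale circ m = {0}"
    using alg_power_subset_alg_power2[where f = dot and g = circ and n = m]
      subspace_0[OF subspace_alg_power] m by blast+
  with \<open>m \<ge> 1\<close> show "nilpotent_alg scale dot \<and> nilpotent_alg scale circ"
    unfolding nilpotent_alg_def by blast
qed

end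

theorem theorem3p6:
  fixes scale :: "'a::field \<Rightarrow> 'b::ab_group_add \<Rightarrow> 'b"
    and dot circ :: "'b \<Rightarrow> 'b \<Rightarrow> 'b"
    and Basis :: "'b set"
  assumes "transposed_novikov_poisson_algebra scale dot circ"
    and "finite_dimensional_vector_space scale Basis"
    and "CHAR('a) \<noteq> 2"
  shows "nilpotent_alg scale dot \<and> nilpotent_alg scale circ
    \<longleftrightarrow> nilpotent_alg2 scale dot circ"
  using assms(1) by (rule transposed_novikov_poisson_algebra.nilpotent_alg2_iff)

end
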